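(* Let $f:\{0,1\}^n\to\{0,1\}$ be a conjunction, and let $\mathrm{Samp}^*(f)$ be an oracle which returns independent samples from some distribution $\mathcal{D}$ supported on $F=f^{-1}(1)$ (not necessarily uniform). Then the algorithm Conj-Test, run with $\mathrm{MQ}(f)$ and $\mathrm{Samp}^*(f)$ in place of the sampling oracle, accepts $f$ with probability $1$.
   Context: A conjunction is an AND of literals (variables or negated variables). $\oplus$ is coordinatewise XOR and $y\preceq x$ means $y_i\le x_i$ for all $i$. Conj-Test (with parameter $\varepsilon>0$ and absolute constants $c_1,c_2$), given a membership oracle for $f$ and a sampling oracle $S$: draw one sample $s$ from $S$, and let $f_s(x):=f(x\oplus s)$ (membership queries to $f_s$ are answered via $\mathrm{MQ}(f)$, and samples for $f_s$ are obtained by drawing $z$ from $S$ and returning $z\oplus s$). Then run on $f_s$: Phase 1: repeat $c_1/\varepsilon$ times: draw samples $x,y$; if $f_s(x\oplus y)=0$, halt and reject. Phase 2: repeat $c_2$ times: draw a sample $x$, draw $y$ uniformly from $\{y:y\preceq x\}$, draw a sample $u$; if $f_s(y\oplus u)=0$, halt and reject. Finally, accept. *)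

theory Defs
  imports "HOL-Probability.Probability"
begin

text \<open>Points of the cube \<open>{0,1}^n\<close> are functions \<open>'n \<Rightarrow> bool\<close> on a finite index type with
  \<open>n = CARD('n)\<close>; the order \<open>y \<preceq> x\<close> is then the library's pointwise order \<open>y \<le> x\<close>.\<close>

definition xor_vec :: "('n \<Rightarrow> bool) \<Rightarrow> ('n \<Rightarrow> bool) \<Rightarrow> ('n \<Rightarrow> bool)"  (infixl "\<oplus>\<^sub>v" 65) where
  "x \<oplus>\<^sub>v y = (\<lambda>i. x i \<noteq> y i)"

datatype 'n literal = Pos 'n | Neg 'n

primrec eval_literal :: "'n literal \<Rightarrow> ('n \<Rightarrow> bool) \<Rightarrow> bool" where
  "eval_literal (Pos i) x \<longleftrightarrow> x i"
| "eval_literal (Neg i) x \<longleftrightarrow> \<not> x i"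

text \<open>The empty conjunction (constant 1) and contradictory ones (constant 0) are included.\<close>

definition is_conjunction :: "(('n \<Rightarrow> bool) \<Rightarrow> bool) \<Rightarrow> bool" where
  "is_conjunction f \<longleftrightarrow> (\<exists>L. \<forall>x. f x \<longleftrightarrow> (\<forall>l\<in>L. eval_literal l x))"

datatype verdict = Accept | Reject

text \<open>A sampling oracle is given by its distribution; each \<open>bind_pmf\<close> from it is a fresh
  independent sample. A membership oracle is the function itself.

  In \<open>repeat_check m b k\<close> the round \<open>b\<close> is run up to \<open>m\<close> times with fresh randomness and returns
  the answer of its membership query; on the first answer 0 the whole computation halts and rejects,
  and if there is none the computation goes on with \<open>k\<close>.\<close>

primrec repeat_check :: "nat \<Rightarrow> bool pmf \<Rightarrow> verdict pmf \<Rightarrow> verdict pmf" where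
  "repeat_check 0 b k = k"
| "repeat_check (Suc m) b k =
     bind_pmf b (\<lambda>answer. if answer then repeat_check m b k else return_pmf Reject)"

definition phase1_round :: "(('n \<Rightarrow> bool) \<Rightarrow> bool) \<Rightarrow> ('n \<Rightarrow> bool) pmf \<Rightarrow> bool pmf" where
  "phase1_round g T =
     bind_pmf T (\<lambda>x.
     bind_pmf T (\<lambda>y.
     return_pmf (g (x \<oplus>\<^sub>v y))))"

definition phase2_round :: "(('n::finite \<Rightarrow> bool) \<Rightarrow> bool) \<Rightarrow> ('n \<Rightarrow> bool) pmf \<Rightarrow> bool pmf" where
  "phase2_round g T =
     bind_pmf T (\<lambda>x.
     bind_pmf (pmf_of_set {y. y \<le> x}) (\<lambda>y.
     bind_pmf T (\<lambda>u.
     return_pmf (g (y \<oplus>\<^sub>v u)))))"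

definition two_phase_test ::
  "real \<Rightarrow> nat \<Rightarrow> real \<Rightarrow> (('n::finite \<Rightarrow> bool) \<Rightarrow> bool) \<Rightarrow> ('n \<Rightarrow> bool) pmf \<Rightarrow> verdict pmf" where
  "two_phase_test c1 c2 \<epsilon> g T =
     repeat_check (nat \<lceil>c1 / \<epsilon>\<rceil>) (phase1_round g T)
       (repeat_check c2 (phase2_round g T)
         (return_pmf Accept))"

definition conj_test ::
  "real \<Rightarrow> nat \<Rightarrow> real \<Rightarrow> (('n::finite \<Rightarrow> bool) \<Rightarrow> bool) \<Rightarrow> ('n \<Rightarrow> bool) pmf \<Rightarrow> verdict pmf" where
  "conj_test c1 c2 \<epsilon> f S =
     bind_pmf S (\<lambda>s.
     two_phase_test c1 c2 \<epsilon> (\<lambda>x. f (x \<oplus>\<^sub>v s)) (map_pmf (\<lambda>z. z \<oplus>\<^sub>v s) S))"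

end

(* Shifting a conjunction f by a satisfying point s turns it into the test that all coordinates
   occurring in f vanish. The vectors vanishing on a fixed set of coordinates are closed under XOR
   and downward closed for the pointwise order, so every query made by the algorithm is answered 1. *)
theory Submission
  imports Defs
begin

text \<open>Since \<open>s\<close> satisfies every literal of \<open>f\<close>, a literal on
  coordinate \<open>i\<close> holds at \<open>x \<oplus>\<^sub>v s\<close> exactly when
  \<open>x\<close> does not flip \<open>i\<close>. So \<open>I\<close> is the set of coordinates
  occurring in \<open>f\<close>, whatever their signs.\<close>

lemma conjunction_shift:
  fixes f :: "('n \<Rightarrow> bool) \<Rightarrow> bool"
  assumes "is_conjunction f" "f s"
  obtains I where "\<And>x. f (x \<oplus>\<^sub>v s) \<longleftrightarrow> (\<forall>i\<in>I. \<not> x i)"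
proof -
  from assms(1) obtain L where L: "\<And>x. f x \<longleftrightarrow> (\<forall>l\<in>L. eval_literal l x)"
    unfolding is_conjunction_def by blast
  have "f (x \<oplus>\<^sub>v s) \<longleftrightarrow> (\<forall>i\<in>{i. Pos i \<in> L \<or> Neg i \<in> L}. \<not> x i)" for x
  proof -
    \<comment> \<open>Regrouping the literals by coordinate lets the values at
      \<open>x \<oplus>\<^sub>v s\<close> and at \<open>s\<close> be compared one coordinate at a
      time.\<close>
    have lit: "(\<forall>l\<in>L. eval_literal l z) \<longleftrightarrow> (\<forall>i. (Pos i \<in> L \<longrightarrow> z i) \<and> (Neg i \<in> L \<longrightarrow> \<not> z i))" for z
      by (metis eval_literal.simps literal.exhaust)
    show ?thesis
      using assms(2) unfolding L lit xor_vec_def by blast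
  qed
  then show ?thesis by (rule that)
qed

lemma repeat_check_True:
  assumes "set_pmf b \<subseteq> {True}"
  shows "repeat_check m b k = k"
proof -
  have "b = return_pmf True"
    using assms by (simp add: set_pmf_subset_singleton)
  then show ?thesis
    by (induction m) (simp_all add: bind_return_pmf)
qed

lemma set_pmf_of_set_below:
  fixes x :: "'n::finite \<Rightarrow> bool"
  shows "set_pmf (pmf_of_set {y. y \<le> x}) = {y. y \<le> x}"
  \<comment> \<open>The set is nonempty because it contains \<open>x\<close> itself.\<close>
  by (rule set_pmf_of_set) auto

text \<open>Stated as an equality of distributions, so that it can be rewritten under the draw of
  \<open>s\<close>.\<close>

lemma two_phase_test_accepts:
  fixes g :: "('n::finite \<Rightarrow> bool) \<Rightarrow> bool"
  assumes g: "\<And>x. g x \<longleftrightarrow> (\<forall>i\<in>I. \<not> x i)" and T: "set_pmf T \<subseteq> {x. g x}"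
  shows "two_phase_test c1 c2 \<epsilon> g T = return_pmf Accept"
proof -
  have xor: "g (x \<oplus>\<^sub>v y)" if "g x" "g y" for x y
    using that by (auto simp: g xor_vec_def)
  have down: "g y" if "g x" "y \<le> x" for x y
    using that by (auto simp: g le_fun_def)
  have "set_pmf (phase1_round g T) \<subseteq> {True}"
    using T by (auto simp: phase1_round_def intro!: xor)
  moreover have "set_pmf (phase2_round g T) \<subseteq> {True}"
    using T by (auto simp: phase2_round_def set_pmf_of_set_below intro!: xor intro: down)
  ultimately show ?thesis
    by (simp add: two_phase_test_def repeat_check_True)
qed

theorem theorem3p18:
  fixes f :: "('n::finite \<Rightarrow> bool) \<Rightarrow> bool"
    and D :: "('n \<Rightarrow> bool) pmf"
    and \<epsilon> c1 :: real
    and c2 :: nat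
  assumes "is_conjunction f"
    and "set_pmf D \<subseteq> {x. f x}"
    and "\<epsilon> > 0" and "c1 > 0" and "c2 > 0"
  shows "measure_pmf.prob (conj_test c1 c2 \<epsilon> f D) {Accept} = 1"
proof -
  have "two_phase_test c1 c2 \<epsilon> (\<lambda>x. f (x \<oplus>\<^sub>v s)) (map_pmf (\<lambda>z. z \<oplus>\<^sub>v s) D) = return_pmf Accept"
    if "s \<in> set_pmf D" for s
  proof -
    have "f s"
      using that assms(2) by blast
    from conjunction_shift[where f = f, OF assms(1) this]
    obtain I where I: "\<And>x. f (x \<oplus>\<^sub>v s) \<longleftrightarrow> (\<forall>i\<in>I. \<not> x i)"
      by blast
    \<comment> \<open>XOR with \<open>s\<close> is an involution, so the shifted function at a
      shifted sample \<open>z \<oplus>\<^sub>v s\<close> takes the value \<open>f z\<close>, which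
      is 1.\<close>
    have "(z \<oplus>\<^sub>v s) \<oplus>\<^sub>v s = z" for z
      by (auto simp: xor_vec_def)
    then have "set_pmf (map_pmf (\<lambda>z. z \<oplus>\<^sub>v s) D) \<subseteq> {x. f (x \<oplus>\<^sub>v s)}"
      using assms(2) by auto
    with I show ?thesis
      by (rule two_phase_test_accepts)
  qed
  \<comment> \<open>The congruence rule restricts attention to \<open>s\<close> in the support of
    \<open>D\<close>, where the test is already known to be constant.\<close>
  then have "conj_test c1 c2 \<epsilon> f D = return_pmf Accept"
    unfolding conj_test_def by (simp cong: bind_pmf_cong)
  then show ?thesis
    by simp
qed

end
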